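(* Let $n\geq 2$ and let $G_n^{P}$ be the flip graph of permutations of $[n]$ (defined in the context). Then: (i) if $\lfloor n/2\rfloor$ is odd, then $G_n^{P}$ has no rainbow cycle; (ii) if $\lfloor n/2\rfloor$ is even, then $G_n^{P}$ has a rainbow cycle.
   Context: $G_n^{P}$ is the undirected graph whose vertices are the permutations $\pi=(\pi(1),\dots,\pi(n))$ of $[n]=\{1,\dots,n\}$, with an edge between two permutations that differ by exchanging the entries at two positions $i\neq j$; this edge is labeled with the pair $\{i,j\}$. A rainbow cycle (1-rainbow cycle) in $G_n^{P}$ is a cycle (no repeated vertices) along which each of the $\binom{n}{2}$ pairs $\{i,j\}\subseteq[n]$ appears exactly once as an edge label. *)

theory Defs
  imports "HOL-Combinatorics.Permutations"
begin

definition perm_flip_vertices :: "nat \<Rightarrow> (nat \<Rightarrow> nat) set" where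
  "perm_flip_vertices n = {p. p permutes {1..n}}"

text \<open>Labelled adjacency: composing with the transposition on the right exchanges the entries
  of the tuple (p 1, ..., p n) at the \<^emph>\<open>positions\<close> i and j, not the values i and j.\<close>

definition perm_flip_edge :: "nat \<Rightarrow> nat set \<Rightarrow> (nat \<Rightarrow> nat) \<Rightarrow> (nat \<Rightarrow> nat) \<Rightarrow> bool" where
  "perm_flip_edge n e p q \<longleftrightarrow>
     p \<in> perm_flip_vertices n \<and> q \<in> perm_flip_vertices n \<and>
     (\<exists>i j. i \<in> {1..n} \<and> j \<in> {1..n} \<and> i \<noteq> j \<and> e = {i, j} \<and> q = p \<circ> transpose i j)"

definition perm_flip_adj :: "nat \<Rightarrow> (nat \<Rightarrow> nat) \<Rightarrow> (nat \<Rightarrow> nat) \<Rightarrow> bool" where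
  "perm_flip_adj n p q \<longleftrightarrow> (\<exists>e. perm_flip_edge n e p q)"

text \<open>A cycle in a simple undirected graph, given by its list of vertices; the successor of the
  last vertex is the first one.\<close>

definition is_cycle :: "('v \<Rightarrow> 'v \<Rightarrow> bool) \<Rightarrow> 'v list \<Rightarrow> bool" where
  "is_cycle adj vs \<longleftrightarrow>
     length vs \<ge> 3 \<and> distinct vs \<and>
     (\<forall>k < length vs. adj (vs ! k) (vs ! (Suc k mod length vs)))"

definition is_rainbow_cycle :: "nat \<Rightarrow> (nat \<Rightarrow> nat) list \<Rightarrow> bool" where
  "is_rainbow_cycle n vs \<longleftrightarrow>
     is_cycle (perm_flip_adj n) vs \<and>
     (\<forall>e. e \<subseteq> {1..n} \<and> card e = 2 \<longrightarrow>
        (\<exists>!k. k < length vs \<and> perm_flip_edge n e (vs ! k) (vs ! (Suc k mod length vs))))"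

definition has_rainbow_cycle :: "nat \<Rightarrow> bool" where
  "has_rainbow_cycle n \<longleftrightarrow> (\<exists>vs. is_rainbow_cycle n vs)"

text \<open>The graph is undirected and loopless, and every edge carries a unique label.\<close>

lemma perm_flip_edge_sym: "perm_flip_edge n e p q \<Longrightarrow> perm_flip_edge n e q p"
  unfolding perm_flip_edge_def by (fastforce simp: comp_assoc)

lemma perm_flip_edge_label:
  assumes "perm_flip_edge n e p q"
  shows "e = {i. p i \<noteq> q i}"
proof -
  obtain i j where ij: "i \<noteq> j" "e = {i, j}" "q = p \<circ> transpose i j"
    and "p permutes {1..n}"
    using assms unfolding perm_flip_edge_def perm_flip_vertices_def by blast
  then have "inj p" by (simp add: permutes_inj)
  then show ?thesis
    using ij by (auto simp: transpose_def inj_eq)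
qed

lemma perm_flip_edge_irrefl: "\<not> perm_flip_edge n e p p"
  using perm_flip_edge_label[of n e p p] unfolding perm_flip_edge_def by auto

end

theory Submission
  imports Defs
begin

text \<open>A cycle is closed, so by the sign of permutations its length is even; a rainbow cycle has
  length n choose 2, which is odd if n div 2 is odd.

  For the converse, a rainbow cycle is encoded by the word of transpositions along its edges,
  starting at the identity. Such a word on an even ground set S is extended to the union of S and a
  disjoint set X with four elements or one element. If X has four elements, fix a rainbow word
  l L on X and replace one letter (c d) by l (c d) L: l commutes with (c d), so the product does not
  change, and the new vertices act nontrivially on X. Finally, choose a perfect matching of S that
  does not contain {c, d}, and for every x in X and every matching edge {a, b} replace the
  letter (a b) by (x b) (a b) (x a), which has the same product. The two new vertices are the only
  ones with the value x at position b or a, respectively.\<close>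

section \<open>Words of transpositions and the walks they trace\<close>

text \<open>The vertices visited from p along the word, each paired with the letter by which it is left;
  the final vertex is omitted.\<close>

fun walk :: "('a \<Rightarrow> 'a) \<Rightarrow> ('a \<times> 'a) list \<Rightarrow> (('a \<Rightarrow> 'a) \<times> 'a \<times> 'a) list" where
  "walk p [] = []"
| "walk p ((i, j) # w) = (p, i, j) # walk (p \<circ> transpose i j) w"

definition label :: "'a \<times> 'a \<Rightarrow> 'a set" where
  "label e = {fst e, snd e}"

text \<open>The end vertex, omitted by \<open>walk\<close>, is the start again because the product
  is \<open>id\<close>, so the listed vertices can all be required distinct. No ground set is fixed:
  words whose labels do not yet exhaust the pairs are covered too.\<close>

definition closed_word :: "('a \<times> 'a) list \<Rightarrow> bool" where
  "closed_word w \<longleftrightarrow>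
     apply_transps w = id \<and> distinct (map fst (walk id w)) \<and> distinct (map label w)"

definition two_subsets :: "'a set \<Rightarrow> 'a set set" where
  "two_subsets A = {e. e \<subseteq> A \<and> card e = 2}"

definition rainbow_word :: "'a set \<Rightarrow> ('a \<times> 'a) list \<Rightarrow> bool" where
  "rainbow_word A w \<longleftrightarrow> closed_word w \<and> label ` set w = two_subsets A"

lemma label_Pair [simp]: "label (i, j) = {i, j}"
  by (simp add: label_def)

lemma pair_mem_two_subsets [simp]: "{i, j} \<in> two_subsets A \<longleftrightarrow> i \<in> A \<and> j \<in> A \<and> i \<noteq> j"
  by (auto simp: two_subsets_def card_insert_if)

lemma walk_append: "walk p (u @ v) = walk p u @ walk (p \<circ> apply_transps u) v"
  by (induction u arbitrary: p) (auto simp: comp_assoc)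

lemma map_snd_walk [simp]: "map snd (walk p w) = w"
  by (induction w arbitrary: p) auto

lemma length_walk [simp]: "length (walk p w) = length w"
  by (induction w arbitrary: p) auto

text \<open>Letters multiply on the right, so left multiplication by \<open>q\<close> translates a
  walk and keeps its letters. Thus a word on a new block can be run from any vertex.\<close>

lemma walk_comp: "walk (q \<circ> p) w = map (apfst ((\<circ>) q)) (walk p w)"
  by (induction w arbitrary: p) (auto simp: comp_assoc)

lemma walk_nth:
  assumes "k < length w"
  shows "walk p w ! k = (p \<circ> apply_transps (take k w), w ! k)"
proof -
  obtain i j where ij: "w ! k = (i, j)"
    by fastforce
  have "w = take k w @ (i, j) # drop (Suc k) w"
    using assms ij by (metis id_take_nth_drop)
  then have "walk p w = walk p (take k w) @ (p \<circ> apply_transps (take k w), i, j) #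
      walk (p \<circ> apply_transps (take k w) \<circ> transpose i j) (drop (Suc k) w)"
    by (metis walk_append walk.simps(2))
  then show ?thesis
    using assms ij by (simp add: nth_append)
qed

lemma rainbow_word_mem:
  assumes "rainbow_word A w" "(i, j) \<in> set w"
  shows "i \<in> A" "j \<in> A" "i \<noteq> j"
proof -
  have "label (i, j) \<in> two_subsets A"
    using assms unfolding rainbow_word_def by blast
  then show "i \<in> A" "j \<in> A" "i \<noteq> j"
    by simp_all
qed

lemma walk_permutes:
  assumes "p permutes A" "\<And>i j. (i, j) \<in> set w \<Longrightarrow> i \<in> A \<and> j \<in> A" "(q, e) \<in> set (walk p w)"
  shows "q permutes A"
  using assms
proof (induction w arbitrary: p)
  case (Cons ij w)
  obtain i j where ij: "ij = (i, j)"
    by fastforce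
  have "p \<circ> transpose i j permutes A"
    using Cons.prems ij by (intro permutes_compose permutes_swap_id) auto
  with Cons ij show ?case
    by auto
qed simp

section \<open>Attaching new points along a matching\<close>

text \<open>The three letters have product \<open>transpose a b\<close>, so every old vertex is
  kept. Since \<open>apply_transps u\<close> fixes \<open>x\<close>, the value \<open>x\<close>
  reaches position \<open>b\<close> and then position \<open>a\<close> in the two added vertices,
  whereas no old vertex has it at either position.\<close>

lemma closed_word_insert_spokes:
  assumes w: "closed_word (u @ (a, b) # v)"
    and ab: "a \<noteq> b" "x \<noteq> a" "x \<noteq> b"
    and fix_x: "apply_transps u x = x"
    and new: "\<And>q e. (q, e) \<in> set (walk id (u @ (a, b) # v)) \<Longrightarrow> q a \<noteq> x \<and> q b \<noteq> x"
    and lab: "{x, a} \<notin> label ` set (u @ (a, b) # v)" "{x, b} \<notin> label ` set (u @ (a, b) # v)"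
  shows "closed_word (u @ (x, b) # (a, b) # (x, a) # v)" (is ?closed)
    and "walk id (u @ (x, b) # (a, b) # (x, a) # v) =
      walk id u @ (apply_transps u, x, b) # (apply_transps u \<circ> transpose x b, a, b) #
        (apply_transps u \<circ> transpose x b \<circ> transpose a b, x, a) #
        walk (apply_transps u \<circ> transpose a b) v" (is ?walk)
proof -
  define p where "p = apply_transps u"
  have conj: "transpose x b \<circ> transpose a b \<circ> transpose x a = transpose a b"
    using ab by (auto simp: fun_eq_iff transpose_def)
  then have conj': "q \<circ> transpose x b \<circ> transpose a b \<circ> transpose x a = q \<circ> transpose a b" for q
    by (simp add: comp_assoc)
  show walk': ?walk
    by (simp add: walk_append conj')
  have walk: "walk id (u @ (a, b) # v) = walk id u @ (p, a, b) # walk (p \<circ> transpose a b) v"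
    by (simp add: walk_append p_def)
  have at_b: "(p \<circ> transpose x b) b = x" and at_a: "(p \<circ> transpose x b \<circ> transpose a b) a = x"
    using fix_x by (simp_all add: p_def)
  have notin: "q \<noteq> p \<circ> transpose x b" "q \<noteq> p \<circ> transpose x b \<circ> transpose a b"
    if "q \<in> fst ` set (walk id (u @ (a, b) # v))" for q
  proof -
    have "q a \<noteq> x" "q b \<noteq> x"
      using new that by force+
    then show "q \<noteq> p \<circ> transpose x b" "q \<noteq> p \<circ> transpose x b \<circ> transpose a b"
      using at_a at_b by auto
  qed
  have "p a \<noteq> x"
    using new[of p "(a, b)"] walk by simp
  \<comment> \<open>Position \<open>a\<close> separates the two new vertices: the first still has
    \<open>p a\<close> there, the second has \<open>x\<close>.\<close>
  then have neq: "p \<circ> transpose x b \<noteq> p \<circ> transpose x b \<circ> transpose a b"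
    using at_a ab by (metis comp_apply transpose_apply_other)
  have "distinct (map fst (walk id (u @ (x, b) # (a, b) # (x, a) # v)))"
    using w neq notin unfolding closed_word_def walk walk' p_def[symmetric]
    by (auto simp del: comp_apply)
  moreover have "apply_transps (u @ (x, b) # (a, b) # (x, a) # v) = id"
    using w conj unfolding closed_word_def by (simp add: comp_assoc[symmetric])
  moreover have "distinct (map label (u @ (x, b) # (a, b) # (x, a) # v))"
    using w lab ab unfolding closed_word_def by (auto simp: doubleton_eq_iff)
  ultimately show ?closed
    unfolding closed_word_def by blast
qed

text \<open>R collects the pairs (x, {a, b}) that are still to be processed.\<close>

lemma attach_spokes_aux:
  fixes w :: "('a \<times> 'a) list"
  assumes "finite R" "closed_word w"
    and "\<And>y e. (y, e) \<in> R \<Longrightarrow> y \<notin> S \<and> e \<subseteq> S \<and> card e = 2 \<and> e \<in> label ` set w"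
    and "\<And>y e z f. (y, e) \<in> R \<Longrightarrow> (z, f) \<in> R \<Longrightarrow> e = f \<or> e \<inter> f = {}"
    and "\<And>y e a. (y, e) \<in> R \<Longrightarrow> a \<in> e \<Longrightarrow> {y, a} \<notin> label ` set w"
    and "\<And>y e q i j. (y, e) \<in> R \<Longrightarrow> (q, i, j) \<in> set (walk id w) \<Longrightarrow>
           y \<notin> q ` e \<and> ({i, j} = e \<longrightarrow> q y = y)"
  shows "\<exists>w'. closed_word w' \<and>
           label ` set w' = label ` set w \<union> {{y, a} | y a e. (y, e) \<in> R \<and> a \<in> e}"
  using assms
\<comment> \<open>The word is generalised because every pair lengthens it. The last assumption is
  the invariant: \<open>y\<close> is never the value at a position in \<open>e\<close>, and it is
  fixed whenever a letter with label \<open>e\<close> is applied.\<close>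
proof (induction R arbitrary: w rule: finite_induct)
  case empty
  then show ?case
    by auto
next
  case (insert r R)
  obtain x e where r: "r = (x, e)"
    by fastforce
  have e: "x \<notin> S" "e \<subseteq> S" "card e = 2" "e \<in> label ` set w"
    using insert.prems(2)[of x e] r by auto
  then obtain ab where "ab \<in> set w" "label ab = e"
    by blast
  moreover obtain a b where "ab = (a, b)"
    by fastforce
  ultimately obtain u v where w: "w = u @ (a, b) # v" and ab: "e = {a, b}"
    using split_list by fastforce
  define p where "p = apply_transps u"
  let ?w = "u @ (x, b) # (a, b) # (x, a) # v"
  have neq: "a \<noteq> b" "x \<noteq> a" "x \<noteq> b"
    using e ab by (auto simp: card_insert_if split: if_splits)
  have walk: "walk id w = walk id u @ (p, a, b) # walk (p \<circ> transpose a b) v"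
    by (simp add: w walk_append p_def)
  have px: "p x = x"
  proof -
    have "(p, a, b) \<in> set (walk id w)"
      by (simp add: walk)
    then show ?thesis
      using insert.prems(5)[of x e p a b] r ab by blast
  qed
  have val: "q a \<noteq> x \<and> q b \<noteq> x" if "(q, f) \<in> set (walk id (u @ (a, b) # v))" for q f
  proof -
    have "(q, fst f, snd f) \<in> set (walk id w)"
      using that w by simp
    then show ?thesis
      using insert.prems(5)[of x e q "fst f" "snd f"] r ab by blast
  qed
  have lab: "{x, a} \<notin> label ` set (u @ (a, b) # v)" "{x, b} \<notin> label ` set (u @ (a, b) # v)"
    using insert.prems(4)[of x e] r ab w by auto
  note spokes = closed_word_insert_spokes[OF insert.prems(1)[unfolded w] neq px[unfolded p_def] val lab]
  have walk': "walk id ?w = walk id u @ (p, x, b) # (p \<circ> transpose x b, a, b) #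
        (p \<circ> transpose x b \<circ> transpose a b, x, a) # walk (p \<circ> transpose a b) v"
    using spokes(2) by (simp add: p_def)
  have labels: "label ` set ?w = label ` set w \<union> {{x, a}, {x, b}}"
    by (auto simp: w)
  have "\<exists>w'. closed_word w' \<and>
          label ` set w' = label ` set ?w \<union> {{y, a} | y a e. (y, e) \<in> R \<and> a \<in> e}"
  proof (rule insert.IH)
    show "closed_word ?w"
      by (rule spokes(1))
  next
    fix y f assume "(y, f) \<in> R"
    then show "y \<notin> S \<and> f \<subseteq> S \<and> card f = 2 \<and> f \<in> label ` set ?w"
      using insert.prems(2)[of y f] labels by auto
  next
    fix y f z g assume "(y, f) \<in> R" "(z, g) \<in> R"
    then show "f = g \<or> f \<inter> g = {}"
      using insert.prems(3)[of y f z g] by auto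
  next
    fix y f c assume R: "(y, f) \<in> R" and c: "c \<in> f"
    have "{y, c} \<notin> label ` set w"
      using insert.prems(4)[of y f c] R c by auto
    \<comment> \<open>As \<open>y\<close> lies outside \<open>S\<close>, a collision forces
      \<open>y = x\<close>; but then \<open>f\<close> differs from \<open>e\<close>, so it is
      disjoint from \<open>e\<close>.\<close>
    moreover have "{y, c} \<noteq> {x, a} \<and> {y, c} \<noteq> {x, b}"
    proof (cases "y = x")
      case True
      then have "f \<noteq> e"
        using R r insert.hyps by auto
      then show ?thesis
        using insert.prems(3)[of y f x e] R r ab c True by (auto simp: doubleton_eq_iff)
    next
      case False
      then show ?thesis
        using insert.prems(2)[of y f] R ab e by (auto simp: doubleton_eq_iff)
    qed
    ultimately show "{y, c} \<notin> label ` set ?w"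
      using labels by auto
  next
    fix y f q i j assume R: "(y, f) \<in> R" and q: "(q, i, j) \<in> set (walk id ?w)"
    have f: "y \<notin> S" "f \<subseteq> S" "card f = 2"
      using insert.prems(2)[of y f] R by auto
    have old: "y \<notin> q' ` f \<and> ({i', j'} = f \<longrightarrow> q' y = y)"
      if "(q', i', j') \<in> set (walk id w)" for q' i' j'
      by (rule insert.prems(5)[OF insertI2[OF R] that])
    have pf: "y \<notin> p ` f" "{a, b} = f \<longrightarrow> p y = y"
      using old[of p a b] walk by auto
    have xf: "x \<notin> f"
      using e f by auto
    \<comment> \<open>A pending pair on the same edge has a point other than \<open>x\<close>; at
      both new vertices the values on this edge are \<open>x\<close> and \<open>p a\<close>, so
      \<open>y\<close> is still absent. On a disjoint edge no value changes.\<close>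
    have cases: "f = {a, b} \<and> y \<noteq> x \<or> a \<notin> f \<and> b \<notin> f"
      using insert.prems(3)[of y f x e] R r ab insert.hyps by auto
    consider "(q, i, j) \<in> set (walk id w)" | "q = p" "i = x" "j = b"
      | "q = p \<circ> transpose x b" "i = a" "j = b"
      | "q = p \<circ> transpose x b \<circ> transpose a b" "i = x" "j = a"
      using q unfolding walk' walk by auto
    then show "y \<notin> q ` f \<and> ({i, j} = f \<longrightarrow> q y = y)"
    proof cases
      case 1
      then show ?thesis
        by (rule old)
    next
      case 2
      then show ?thesis
        using pf xf by auto
    next
      case 3
      have "y \<noteq> b"
        using ab e f by auto
      then show ?thesis
        using 3 cases pf xf px neq by (auto simp: transpose_def image_iff)
    next
      case 4
      then show ?thesis
        using cases pf xf px neq by (auto simp: transpose_def image_iff)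
    qed
  qed
  moreover have "{{y, a} | y a e. (y, e) \<in> insert r R \<and> a \<in> e} =
      {{x, a}, {x, b}} \<union> {{y, a} | y a e. (y, e) \<in> R \<and> a \<in> e}"
    using r ab by auto
  ultimately show ?case
    by (simp only: labels Un_assoc)
qed

text \<open>Every \<open>a\<close> in \<open>S\<close> lies on one edge of the perfect matching
  \<open>M\<close>, so treating all of \<open>X \<times> M\<close> yields each pair
  \<open>{x, a}\<close>. If a vertex maps \<open>S\<close> into \<open>S\<close>, no
  \<open>x\<close> in \<open>X\<close> is a value at a position in \<open>S\<close>, which provides
  the invariant.\<close>

lemma attach_spokes:
  fixes w :: "('a \<times> 'a) list"
  assumes "finite S" "finite X" "S \<inter> X = {}" "closed_word w"
    and M: "\<Union>M = S" "M \<subseteq> label ` set w" "\<And>e. e \<in> M \<Longrightarrow> card e = 2"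
      "\<And>e f. e \<in> M \<Longrightarrow> f \<in> M \<Longrightarrow> e = f \<or> e \<inter> f = {}"
    and lab: "\<And>x a. x \<in> X \<Longrightarrow> a \<in> S \<Longrightarrow> {x, a} \<notin> label ` set w"
    and val: "\<And>q i j. (q, i, j) \<in> set (walk id w) \<Longrightarrow> q ` S \<subseteq> S \<and> ({i, j} \<in> M \<longrightarrow> (\<forall>x\<in>X. q x = x))"
  shows "\<exists>w'. closed_word w' \<and> label ` set w' = label ` set w \<union> {{x, a} | x a. x \<in> X \<and> a \<in> S}"
proof -
  have "finite M"
    using M(1) assms(1) by (simp add: finite_UnionD)
  then have "\<exists>w'. closed_word w' \<and>
      label ` set w' = label ` set w \<union> {{y, a} | y a e. (y, e) \<in> X \<times> M \<and> a \<in> e}"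
  proof (rule attach_spokes_aux[where S = S, OF finite_cartesian_product[OF assms(2)]])
    show "closed_word w"
      by fact
  next
    fix y e assume "(y, e) \<in> X \<times> M"
    then show "y \<notin> S \<and> e \<subseteq> S \<and> card e = 2 \<and> e \<in> label ` set w"
      using assms(3) M by blast
  next
    fix y e z f assume "(y, e) \<in> X \<times> M" "(z, f) \<in> X \<times> M"
    then show "e = f \<or> e \<inter> f = {}"
      using M(4) by blast
  next
    fix y e a assume "(y, e) \<in> X \<times> M" "a \<in> e"
    then show "{y, a} \<notin> label ` set w"
      using lab M(1) by blast
  next
    fix y e q i j assume R: "(y, e) \<in> X \<times> M" and q: "(q, i, j) \<in> set (walk id w)"
    then have "q ` e \<subseteq> S" "y \<notin> S"
      using val[OF q] M(1) assms(3) by blast+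
    then show "y \<notin> q ` e \<and> ({i, j} = e \<longrightarrow> q y = y)"
      using R val[OF q] by blast
  qed
  moreover have "{{y, a} | y a e. (y, e) \<in> X \<times> M \<and> a \<in> e} = {{x, a} | x a. x \<in> X \<and> a \<in> S}"
    using M(1) by blast
  ultimately show ?thesis
    by simp
qed

section \<open>Gluing in a rainbow word on a disjoint set\<close>

lemma two_subsets_Un:
  assumes "S \<inter> X = {}"
  shows "two_subsets (S \<union> X) =
           two_subsets S \<union> two_subsets X \<union> {{x, a} | x a. x \<in> X \<and> a \<in> S}"
proof
  show "two_subsets (S \<union> X) \<subseteq>
      two_subsets S \<union> two_subsets X \<union> {{x, a} | x a. x \<in> X \<and> a \<in> S}"
  proof
    fix e assume e: "e \<in> two_subsets (S \<union> X)"
    then obtain i j where ij: "e = {i, j}"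
      by (auto simp: two_subsets_def card_2_iff)
    then consider "i \<in> S" "j \<in> S" | "i \<in> X" "j \<in> X" | "i \<in> S" "j \<in> X" | "i \<in> X" "j \<in> S"
      using e by auto
    then show "e \<in> two_subsets S \<union> two_subsets X \<union> {{x, a} | x a. x \<in> X \<and> a \<in> S}"
      using e unfolding ij by cases (auto simp: insert_commute)
  qed
  have "two_subsets S \<union> two_subsets X \<subseteq> two_subsets (S \<union> X)"
    by (auto simp: two_subsets_def)
  moreover have "{{x, a} | x a. x \<in> X \<and> a \<in> S} \<subseteq> two_subsets (S \<union> X)"
    using assms by auto
  ultimately show "two_subsets S \<union> two_subsets X \<union> {{x, a} | x a. x \<in> X \<and> a \<in> S} \<subseteq>
      two_subsets (S \<union> X)"
    by simp
qed

lemma two_subsets_singleton [simp]: "two_subsets {x} = {}"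
  by (auto simp: two_subsets_def card_2_iff)

lemma two_subsets_insert:
  assumes "x \<notin> A"
  shows "two_subsets (insert x A) = two_subsets A \<union> (\<lambda>a. {x, a}) ` A"
  using two_subsets_Un[of A "{x}"] assms by auto

lemma rainbow_word_walk_permutes:
  assumes "rainbow_word A w" "(q, e) \<in> set (walk id w)"
  shows "q permutes A"
  using walk_permutes[OF permutes_id _ assms(2)] rainbow_word_mem[OF assms(1)] by blast

text \<open>The last clause prepares the spokes: \<open>{c, d}\<close> is the only pair in
  \<open>S\<close> whose letter may be applied while points of \<open>X\<close> are displaced, so
  any matching avoiding it can be used.\<close>

lemma insert_rainbow_word:
  fixes w :: "('a \<times> 'a) list"
  assumes w: "rainbow_word S w" and L: "rainbow_word X L" "L \<noteq> []"
    and SX: "S \<inter> X = {}" and cd: "c \<in> S" "d \<in> S" "c \<noteq> d"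
  shows "\<exists>w'. closed_word w' \<and> label ` set w' = two_subsets S \<union> two_subsets X \<and>
           (\<forall>q i j. (q, i, j) \<in> set (walk id w') \<longrightarrow>
              q ` S \<subseteq> S \<and> ({i, j} \<subseteq> S \<and> {i, j} \<noteq> {c, d} \<longrightarrow> (\<forall>x\<in>X. q x = x)))"
proof -
  have "{c, d} \<in> label ` set w"
    using w cd by (simp add: rainbow_word_def)
  \<comment> \<open>The word may list the pair \<open>{c, d}\<close> in either order.\<close>
  then obtain g h where "(g, h) \<in> set w" and gh: "{g, h} = {c, d}"
    by auto
  then obtain u v where uv: "w = u @ (g, h) # v"
    using split_list by fastforce
  obtain k l L' where L': "L = (k, l) # L'"
    using L(2) by (metis neq_Nil_conv surj_pair)
  have kl: "k \<in> X" "l \<in> X" "k \<noteq> l"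
    using rainbow_word_mem[OF L(1), of k l] L' by auto
  have ghS: "g \<in> S" "h \<in> S" "g \<noteq> h"
    using gh cd by (auto simp: doubleton_eq_iff)
  define p where "p = apply_transps u"
  define q where "q = p \<circ> transpose g h"
  let ?t = "transpose k l"
  let ?w = "u @ (k, l) # (g, h) # L' @ v"
  have walk: "walk id w = walk id u @ (p, g, h) # walk q v"
    by (simp add: uv walk_append p_def q_def)
  have walkL: "walk id L = (id, k, l) # walk ?t L'"
    by (simp add: L')
  have endL: "?t \<circ> apply_transps L' = id"
    using L by (simp add: rainbow_word_def closed_word_def L')
  have comm: "?t \<circ> transpose g h = transpose g h \<circ> ?t"
    using kl ghS SX by (auto simp: fun_eq_iff transpose_def)
  \<comment> \<open>After \<open>(k, l)\<close> and \<open>(g, h)\<close> the walk stands at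
    \<open>q \<circ> ?t\<close>. From there it follows the walk of \<open>L'\<close> translated by
    \<open>q\<close> and ends in \<open>q\<close>, where the old walk resumes.\<close>
  have walk': "walk id ?w = walk id u @ (p, k, l) # (p \<circ> ?t, g, h) #
      map (apfst ((\<circ>) q)) (walk ?t L') @ walk q v"
  proof -
    have "p \<circ> ?t \<circ> transpose g h = q \<circ> ?t"
      by (simp add: q_def comm comp_assoc)
    moreover have "q \<circ> ?t \<circ> apply_transps L' = q"
      by (simp add: comp_assoc endL)
    ultimately show ?thesis
      by (simp add: walk_append p_def[symmetric] walk_comp)
  qed
  have permS: "r permutes S" if "r \<in> fst ` set (walk id w)" for r
    using that rainbow_word_walk_permutes[OF w] by auto
  have p: "p permutes S"
    using permS walk by simp
  then have q: "q permutes S"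
    unfolding q_def using ghS by (intro permutes_compose permutes_swap_id)
  have permX: "m permutes X" if "m \<in> fst ` set (walk id L)" for m
    using that rainbow_word_walk_permutes[OF L(1)] by auto
  have fixX: "r x = x" if "r permutes S" "x \<in> X" for r x
    using that SX by (meson disjoint_iff permutes_not_in)
  have fixS: "m x = x" if "m permutes X" "x \<in> S" for m x
    using that SX by (meson disjoint_iff permutes_not_in)
  \<comment> \<open>\<open>m\<close> differs from \<open>id\<close>, the first vertex of the walk of
    \<open>L\<close>, so it moves some \<open>x\<close> in \<open>X\<close>, and \<open>r\<close>
    fixes \<open>m x\<close>. Hence \<open>r \<circ> m\<close> moves \<open>x\<close>, which no
    permutation of \<open>S\<close> does.\<close>
  have new: "r \<circ> m \<notin> fst ` set (walk id w)" if "r permutes S" "m \<in> fst ` set (walk ?t L')" for r m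
  proof
    assume "r \<circ> m \<in> fst ` set (walk id w)"
    then have rm: "r \<circ> m permutes S"
      by (rule permS)
    have m: "m permutes X"
      using that permX walkL by simp
    moreover have "m \<noteq> id"
      using L that walkL unfolding rainbow_word_def closed_word_def
      by (metis distinct.simps(2) fst_conv image_set list.simps(9))
    ultimately obtain x where x: "x \<in> X" "m x \<noteq> x"
      by (metis eq_id_iff permutes_not_in)
    then have "r (m x) = m x"
      using fixX[OF that(1)] m by (simp add: permutes_in_image)
    then show False
      using fixX[OF rm x(1)] x(2) by simp
  qed
  have t_new: "p \<circ> ?t \<notin> fst ` set (walk id w)"
  proof
    assume "p \<circ> ?t \<in> fst ` set (walk id w)"
    then have "(p \<circ> ?t) k = k"
      using permS fixX kl by blast
    then show False
      using fixX[OF p] kl by simp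
  qed
  \<comment> \<open>At position \<open>g\<close> the values are \<open>p g\<close> and
    \<open>p h\<close>, since \<open>?t\<close> and \<open>m\<close> fix all points of
    \<open>S\<close>.\<close>
  have t_neq: "p \<circ> ?t \<noteq> q \<circ> m" if "m \<in> fst ` set (walk ?t L')" for m
  proof
    assume eq: "p \<circ> ?t = q \<circ> m"
    have "m permutes X"
      using that permX walkL by simp
    then have "(q \<circ> m) g = p h"
      using fixS[of m g] ghS by (simp add: q_def)
    moreover have "(p \<circ> ?t) g = p g"
      using fixS[OF permutes_swap_id] kl ghS by (metis comp_apply)
    ultimately show False
      using eq ghS p by (metis permutes_inj inj_eq)
  qed
  have injq: "inj ((\<circ>) q)"
    using q by (auto intro!: injI simp: fun_eq_iff permutes_inj inj_eq)
  have "distinct (map fst (walk id L))"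
    using L by (simp add: rainbow_word_def closed_word_def)
  then have dL: "distinct (map ((\<circ>) q) (map fst (walk ?t L')))"
    unfolding walkL using inj_on_subset[OF injq] by (subst distinct_map) simp
  let ?N = "map ((\<circ>) q) (map fst (walk ?t L'))"
  have splice: "distinct (U @ r # s # N @ V)"
    if "distinct (U @ r # V)" "distinct N" "set N \<inter> set (U @ r # V) = {}"
      "s \<notin> set (U @ r # V)" "s \<notin> set N" for U V N and r s :: "'a \<Rightarrow> 'a"
    using that by auto
  have vs: "map fst (walk id w) = map fst (walk id u) @ p # map fst (walk q v)"
    by (simp add: walk)
  have "distinct (map fst (walk id w))"
    using w by (simp add: rainbow_word_def closed_word_def)
  moreover have "set ?N \<inter> set (map fst (walk id w)) = {}"
  proof -
    have "q \<circ> m \<notin> set (map fst (walk id w))" if "m \<in> set (map fst (walk ?t L'))" for m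
      using new[OF q, of m] that unfolding set_map by blast
    then show ?thesis
      unfolding set_map[of "(\<circ>) q"] by blast
  qed
  moreover have "p \<circ> ?t \<notin> set (map fst (walk id w))"
    using t_new by simp
  moreover have "p \<circ> ?t \<notin> set ?N"
    using t_neq unfolding set_map by blast
  ultimately have "distinct (map fst (walk id u) @ p # (p \<circ> ?t) # ?N @ map fst (walk q v))"
    using dL unfolding vs by (intro splice)
  then have "distinct (map fst (walk id ?w))"
    by (simp add: walk')
  moreover have "apply_transps ?w = id"
  proof -
    have "apply_transps ?w = p \<circ> (?t \<circ> transpose g h) \<circ> apply_transps L' \<circ> apply_transps v"
      by (simp add: p_def comp_assoc)
    also have "\<dots> = p \<circ> transpose g h \<circ> (?t \<circ> apply_transps L') \<circ> apply_transps v"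
      unfolding comm by (simp add: comp_assoc)
    also have "\<dots> = id"
      using w unfolding endL by (simp add: rainbow_word_def closed_word_def uv p_def comp_assoc)
    finally show ?thesis .
  qed
  moreover have labels: "label ` set ?w = two_subsets S \<union> two_subsets X"
    using w L unfolding rainbow_word_def uv L' by auto
  moreover have "distinct (map label ?w)"
  proof -
    have "two_subsets S \<inter> two_subsets X = {}"
      using SX by (fastforce simp: two_subsets_def card_2_iff)
    then have "label ` set w \<inter> label ` set L = {}" "distinct (map label w)" "distinct (map label L)"
      using w L by (simp_all add: rainbow_word_def closed_word_def)
    moreover have "distinct (U @ y # z # N @ V)"
      if "set (U @ z # V) \<inter> set (y # N) = {}" "distinct (U @ z # V)" "distinct (y # N)"
      for U N V and y z :: "'a set"
      using that by auto
    ultimately show ?thesis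
      unfolding uv L' set_map[symmetric] map_append list.map by blast
  qed
  moreover have "r ` S \<subseteq> S \<and> ({i, j} \<subseteq> S \<and> {i, j} \<noteq> {c, d} \<longrightarrow> (\<forall>x\<in>X. r x = x))"
    if r: "(r, i, j) \<in> set (walk id ?w)" for r i j
  proof -
    consider "(r, i, j) \<in> set (walk id w)" | "r = p" | "r = p \<circ> ?t" "{i, j} = {c, d}"
      | m where "r = q \<circ> m" "(m, i, j) \<in> set (walk ?t L')"
      using r gh unfolding walk' walk by (auto simp del: comp_apply)
    then consider "r permutes S" | "r = p \<circ> ?t" "{i, j} = {c, d}"
      | m where "r = q \<circ> m" "(m, i, j) \<in> set (walk ?t L')"
      using rainbow_word_walk_permutes[OF w] p by metis
    then show ?thesis
    proof cases
      case 1
      then show ?thesis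
        using fixX by (auto simp: permutes_in_image)
    next
      case 2
      then show ?thesis
        using p fixS[OF permutes_swap_id, OF kl(1,2)] by (auto simp: permutes_in_image)
    next
      case 3
      then have mem: "(m, i, j) \<in> set (walk id L)"
        by (simp add: walkL)
      then have "(i, j) \<in> set L"
        using map_snd_walk[of id L] by (metis image_eqI set_map snd_conv)
      \<comment> \<open>The letter comes from \<open>L\<close>, so its label is not contained in
        \<open>S\<close> and the second claim is vacuous.\<close>
      then have "i \<in> X"
        by (rule rainbow_word_mem(1)[OF L(1)])
      moreover have "m permutes X"
        by (rule rainbow_word_walk_permutes[OF L(1) mem])
      ultimately show ?thesis
        using q 3 SX by (auto simp: permutes_in_image fixS)
    qed
  qed
  ultimately show ?thesis
    unfolding closed_word_def by blast
qed

section \<open>The rainbow word on four points\<close>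

text \<open>The middle four letters form two double transpositions of the Klein four-group, whose
  product is the third one, \<open>(x y)(z t)\<close>; the first and the last letter cancel
  it.\<close>

lemma rainbow_word_four:
  assumes "distinct [x, y, z, t]"
  shows "rainbow_word {x, y, z, t} [(x, y), (x, z), (y, t), (x, t), (y, z), (z, t)]"
    (is "rainbow_word _ ?w")
proof -
  \<comment> \<open>Values at the four points suffice to tell the vertices apart.\<close>
  have neq: "p \<noteq> q" if "map p [x, y, z, t] \<noteq> map q [x, y, z, t]" for p q :: "'a \<Rightarrow> 'a"
    using that by auto
  have ne: "x \<noteq> y" "x \<noteq> z" "x \<noteq> t" "y \<noteq> z" "y \<noteq> t" "z \<noteq> t"
    using assms by auto
  have "two_subsets {x, y, z, t} = {{x, y}, {x, z}, {y, t}, {x, t}, {y, z}, {z, t}}"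
    using assms by (simp add: two_subsets_insert) (simp add: insert_commute)
  moreover have "distinct (map fst (walk id ?w))"
    by (simp del: comp_apply, intro conjI; intro neq; simp add: transpose_def ne ne[symmetric])
  moreover have "apply_transps ?w = id"
    by (simp add: fun_eq_iff transpose_def ne ne[symmetric])
  moreover have "distinct (map label ?w)"
    by (simp add: doubleton_eq_iff ne ne[symmetric])
  ultimately show ?thesis
    unfolding rainbow_word_def closed_word_def by simp
qed

section \<open>A perfect matching of an initial segment\<close>

text \<open>For even \<open>n\<close> this is the matching that carries the spokes. It avoids
  \<open>{1, 3}\<close>, the pair at which four new points are glued in.\<close>

definition matching_upto :: "nat \<Rightarrow> nat set set" where
  "matching_upto n = {{2 * i + 1, 2 * i + 2} | i. i < n div 2}"

lemma Union_matching_upto: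
  assumes "even n"
  shows "\<Union>(matching_upto n) = {1..n}"
proof
  show "\<Union>(matching_upto n) \<subseteq> {1..n}"
    by (auto simp: matching_upto_def)
  show "{1..n} \<subseteq> \<Union>(matching_upto n)"
  proof
    fix k assume k: "k \<in> {1..n}"
    define i where "i = (k - 1) div 2"
    have "i < n div 2" "k = 2 * i + 1 \<or> k = 2 * i + 2"
      using k assms unfolding i_def by (auto elim!: evenE)
    then show "k \<in> \<Union>(matching_upto n)"
      unfolding matching_upto_def by blast
  qed
qed

lemma matching_upto_disjoint:
  assumes "e \<in> matching_upto n" "f \<in> matching_upto n"
  shows "e = f \<or> e \<inter> f = {}"
proof -
  obtain i j where ij: "e = {2 * i + 1, 2 * i + 2}" "f = {2 * j + 1, 2 * j + 2}"
    using assms by (auto simp: matching_upto_def)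
  show ?thesis
  proof (cases "i = j")
    case False
    then have "2 * i + 1 \<noteq> 2 * j + 2" "2 * i + 2 \<noteq> 2 * j + 1"
      by presburger+
    then show ?thesis
      using False ij by auto
  qed (simp add: ij)
qed

lemma matching_upto_card: "e \<in> matching_upto n \<Longrightarrow> card e = 2"
  by (auto simp: matching_upto_def)

lemma matching_upto_subset:
  assumes "even n"
  shows "matching_upto n \<subseteq> two_subsets {1..n}"
  using Union_matching_upto[OF assms] matching_upto_card by (fastforce simp: two_subsets_def)

section \<open>Enlarging the ground set by one or four points\<close>

text \<open>A single point has no pairs of its own, so the spokes supply all missing labels; every
  vertex of the old walk fixes \<open>Suc n\<close>.\<close>

lemma rainbow_word_add_one:
  assumes "even n" "rainbow_word {1..n} w"
  shows "\<exists>w'. rainbow_word {1..Suc n} w'"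
proof -
  have lab: "label ` set w = two_subsets {1..n}"
    using assms by (simp add: rainbow_word_def)
  have perm: "q permutes {1..n}" if "(q, i, j) \<in> set (walk id w)" for q i j
    using rainbow_word_walk_permutes[OF assms(2) that] .
  have "\<exists>w'. closed_word w' \<and>
      label ` set w' = label ` set w \<union> {{x, a} | x a. x \<in> {Suc n} \<and> a \<in> {1..n}}"
  proof (rule attach_spokes)
    show "closed_word w"
      using assms by (simp add: rainbow_word_def)
    show "\<Union>(matching_upto n) = {1..n}" "matching_upto n \<subseteq> label ` set w"
      using Union_matching_upto matching_upto_subset assms lab by auto
    show "q ` {1..n} \<subseteq> {1..n} \<and> ({i, j} \<in> matching_upto n \<longrightarrow> (\<forall>x\<in>{Suc n}. q x = x))"
      if "(q, i, j) \<in> set (walk id w)" for q i j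
      using perm[OF that] by (simp add: permutes_image permutes_not_in)
    show "{x, a} \<notin> label ` set w" if "x \<in> {Suc n}" "a \<in> {1..n}" for x a
      using that lab by simp
  qed (simp_all add: matching_upto_card matching_upto_disjoint)
  moreover have "{{x, a} | x a. x \<in> {Suc n} \<and> a \<in> {1..n}} = (\<lambda>a. {Suc n, a}) ` {1..n}"
    by auto
  moreover have "{1..Suc n} = insert (Suc n) {1..n}"
    by auto
  ultimately show ?thesis
    using lab two_subsets_insert[of "Suc n" "{1..n}"] by (simp add: rainbow_word_def)
qed

text \<open>Gluing at \<open>{1, 3}\<close> supplies the pairs among the new points, and spokes
  supply the mixed pairs. \<open>n \<ge> 4\<close> makes \<open>{1, 3}\<close> a pair of
  \<open>{1..n}\<close>.\<close>

lemma rainbow_word_add_four: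
  fixes n :: nat
  assumes "even n" "n \<ge> 4" "rainbow_word {1..n} w"
  shows "\<exists>w'. rainbow_word {1..n + 4} w'"
proof -
  define X where "X = {n + 1, n + 2, n + 3, n + 4}"
  have X: "{1..n} \<inter> X = {}" "finite X" "{1..n + 4} = {1..n} \<union> X"
    by (auto simp: X_def)
  obtain L where L: "rainbow_word X L" "L \<noteq> []"
    using rainbow_word_four[of "n + 1" "n + 2" "n + 3" "n + 4"] unfolding X_def by auto
  obtain v where v: "closed_word v" "label ` set v = two_subsets {1..n} \<union> two_subsets X"
    "\<And>q i j. (q, i, j) \<in> set (walk id v) \<Longrightarrow> q ` {1..n} \<subseteq> {1..n} \<and>
       ({i, j} \<subseteq> {1..n} \<and> {i, j} \<noteq> {1, 3} \<longrightarrow> (\<forall>x\<in>X. q x = x))"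
    using insert_rainbow_word[OF assms(3) L X(1), of 1 3] assms(2) by auto
  have "\<exists>w'. closed_word w' \<and>
      label ` set w' = label ` set v \<union> {{x, a} | x a. x \<in> X \<and> a \<in> {1..n}}"
  proof (rule attach_spokes[OF _ X(2,1) v(1)])
    show "\<Union>(matching_upto n) = {1..n}" "matching_upto n \<subseteq> label ` set v"
      using Union_matching_upto[OF assms(1)] matching_upto_subset[OF assms(1)] v(2) by blast+
    have "{1, 3} \<notin> matching_upto n"
      by (auto simp: matching_upto_def doubleton_eq_iff)
    moreover have "e \<subseteq> {1..n}" if "e \<in> matching_upto n" for e
      using that Union_matching_upto[OF assms(1)] by blast
    ultimately show "q ` {1..n} \<subseteq> {1..n} \<and> ({i, j} \<in> matching_upto n \<longrightarrow> (\<forall>x\<in>X. q x = x))"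
      if "(q, i, j) \<in> set (walk id v)" for q i j
      using v(3)[OF that] by metis
    show "{x, a} \<notin> label ` set v" if "x \<in> X" "a \<in> {1..n}" for x a
      using that v X by auto
  qed (simp_all add: matching_upto_card matching_upto_disjoint)
  then show ?thesis
    using v(2) two_subsets_Un[OF X(1)] X(3) by (simp add: rainbow_word_def)
qed

lemma rainbow_word_four_dvd:
  "\<exists>w. rainbow_word {1..4 * Suc k} w"
proof (induction k)
  case 0
  have "{1..4} = {1, 2, 3, 4::nat}"
    by auto
  then show ?case
    using rainbow_word_four[of 1 2 3 "4::nat"] by auto
next
  case (Suc k)
  then obtain w where "rainbow_word {1..4 * Suc k} w"
    by blast
  then show ?case
    using rainbow_word_add_four[of "4 * Suc k" w] by (simp add: add.commute)
qed

lemma rainbow_word_exists: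
  fixes n :: nat
  assumes "n \<ge> 2" "even (n div 2)"
  shows "\<exists>w. rainbow_word {1..n} w"
proof -
  \<comment> \<open>An even \<open>n div 2\<close> means that \<open>n\<close> is 0 or 1 modulo 4;
    in the second case one point is added at the very end.\<close>
  have "n = 4 * (n div 4) \<or> n = Suc (4 * (n div 4))" "n div 4 \<noteq> 0"
    using assms by presburger+
  then obtain k where "n = 4 * Suc k \<or> n = Suc (4 * Suc k)"
    by (metis not0_implies_Suc)
  moreover obtain w where "rainbow_word {1..4 * Suc k} w"
    using rainbow_word_four_dvd by blast
  ultimately show ?thesis
    using rainbow_word_add_one[of "4 * Suc k" w] by auto
qed

section \<open>Reading a rainbow word as a cycle\<close>

text \<open>Vertex \<open>k\<close> is the product of the first \<open>k\<close> letters, so step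
  \<open>k\<close> exchanges the positions in letter \<open>k\<close>. An edge determines its label,
  so distinct labels give uniqueness.\<close>

lemma is_rainbow_cycle_of_word:
  assumes w: "rainbow_word {1..n} w" and n: "n \<ge> 3"
  shows "is_rainbow_cycle n (map fst (walk id w))"
proof -
  let ?vs = "map fst (walk id w)"
  have closed: "apply_transps w = id" "distinct ?vs" "distinct (map label w)"
    and labels: "label ` set w = two_subsets {1..n}"
    using w by (auto simp: rainbow_word_def closed_word_def)
  have vs: "?vs ! k = apply_transps (take k w)" if "k < length w" for k
    using that by (simp add: walk_nth)
  \<comment> \<open>At the last index the successor wraps around to \<open>id\<close>, which is the
    product of the whole word.\<close>
  have vs_Suc: "?vs ! (Suc k mod length w) = apply_transps (take (Suc k) w)" if "k < length w" for k
  proof (cases "Suc k = length w")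
    case True
    then have "?vs ! (Suc k mod length w) = id"
      using vs[of 0] that by (metis apply_transps_Nil gr_zeroI mod_self not_less_zero take_0)
    then show ?thesis
      using closed(1) True by simp
  next
    case False
    then show ?thesis
      using that vs[of "Suc k"] by (simp del: nth_map)
  qed
  have perm: "apply_transps (take k w) permutes {1..n}" for k
    using rainbow_word_mem[OF w] in_set_takeD[of _ k w]
    by (intro permutes_apply_transps) fastforce
  have edge: "perm_flip_edge n (label (w ! k)) (?vs ! k) (?vs ! (Suc k mod length w))"
    if k: "k < length w" for k
  proof -
    obtain i j where ij: "w ! k = (i, j)"
      by fastforce
    then have "i \<in> {1..n}" "j \<in> {1..n}" "i \<noteq> j"
      using rainbow_word_mem[OF w, of i j] k nth_mem by metis+
    moreover have "apply_transps (take (Suc k) w) = apply_transps (take k w) \<circ> transpose i j"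
      using k ij by (simp add: take_Suc_conv_app_nth)
    ultimately show ?thesis
      unfolding perm_flip_edge_def perm_flip_vertices_def vs[OF k] vs_Suc[OF k]
      using perm[of k] perm[of "Suc k"] ij by fastforce
  qed
  \<comment> \<open>The pairs within \<open>{1, 2, 3}\<close> already require three letters.\<close>
  have "length ?vs \<ge> 3"
  proof -
    have "card {{1, 2}, {1, 3}, {2, 3::nat}} = 3"
      by (simp add: doubleton_eq_iff)
    moreover have "{{1, 2}, {1, 3}, {2, 3}} \<subseteq> label ` set w"
      using n by (auto simp: labels)
    then have "card {{1, 2}, {1, 3}, {2, 3::nat}} \<le> card (label ` set w)"
      by (intro card_mono) auto
    moreover have "card (label ` set w) \<le> length w"
      using card_image_le card_length le_trans by blast
    ultimately show ?thesis
      by simp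
  qed
  then have "is_cycle (perm_flip_adj n) ?vs"
    using closed edge unfolding is_cycle_def perm_flip_adj_def by auto
  moreover have "\<exists>!k. k < length ?vs \<and> perm_flip_edge n e (?vs ! k) (?vs ! (Suc k mod length ?vs))"
    if "e \<subseteq> {1..n} \<and> card e = 2" for e
  proof -
    have "e \<in> label ` set w"
      using that by (simp add: labels two_subsets_def)
    then obtain k where k: "k < length w" "label (w ! k) = e"
      by (metis imageE in_set_conv_nth)
    have "m = k"
      if "m < length w" "perm_flip_edge n e (?vs ! m) (?vs ! (Suc m mod length w))" for m
    proof -
      have "label (w ! m) = e"
        using that edge perm_flip_edge_label by metis
      then show ?thesis
        using closed(3) k that(1) by (metis length_map nth_eq_iff_index_eq nth_map)
    qed
    moreover have "perm_flip_edge n e (?vs ! k) (?vs ! (Suc k mod length w))"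
      using edge[OF k(1)] k(2) by simp
    ultimately show ?thesis
      using k(1) unfolding length_map length_walk by blast
  qed
  ultimately show ?thesis
    unfolding is_rainbow_cycle_def by blast
qed

section \<open>The parity obstruction\<close>

text \<open>Sending each step of the cycle to its label is a bijection onto the pairs: each step has
  a label, and each pair labels exactly one step.\<close>

lemma is_rainbow_cycle_length:
  assumes "is_rainbow_cycle n vs"
  shows "length vs = n choose 2"
proof -
  let ?E = "\<lambda>e k. perm_flip_edge n e (vs ! k) (vs ! (Suc k mod length vs))"
  \<comment> \<open>The label is recovered as the set of positions where consecutive vertices
    differ, which avoids a choice.\<close>
  let ?lab = "\<lambda>k. {i. (vs ! k) i \<noteq> (vs ! (Suc k mod length vs)) i}"
  have ex1: "\<exists>!k. k < length vs \<and> ?E e k" if "e \<in> two_subsets {1..n}" for e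
    using assms that by (simp add: is_rainbow_cycle_def two_subsets_def)
  have edge: "?E (?lab k) k" if "k < length vs" for k
    using assms that perm_flip_edge_label
    unfolding is_rainbow_cycle_def is_cycle_def perm_flip_adj_def by metis
  have mem: "e \<in> two_subsets {1..n}" if "?E e k" for e k
    using that unfolding perm_flip_edge_def by auto
  have "bij_betw ?lab {..<length vs} (two_subsets {1..n})"
    unfolding bij_betw_def
  proof
    show "inj_on ?lab {..<length vs}"
    proof (rule inj_onI)
      fix k m assume km: "k \<in> {..<length vs}" "m \<in> {..<length vs}" "?lab k = ?lab m"
      then have "?E (?lab k) k" "?E (?lab k) m"
        using edge[of k] edge[of m] by simp_all
      then show "k = m"
        using ex1[OF mem] km by blast
    qed
    show "?lab ` {..<length vs} = two_subsets {1..n}"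
    proof
      show "?lab ` {..<length vs} \<subseteq> two_subsets {1..n}"
        using edge mem by blast
      show "two_subsets {1..n} \<subseteq> ?lab ` {..<length vs}"
      proof
        fix e assume "e \<in> two_subsets {1..n}"
        then obtain k where k: "k < length vs" "?E e k"
          using ex1 by blast
        from k(2) have "e = ?lab k"
          by (rule perm_flip_edge_label)
        then show "e \<in> ?lab ` {..<length vs}"
          using k(1) by (intro image_eqI[of _ _ k]) simp_all
      qed
    qed
  qed
  then have "length vs = card (two_subsets {1..n})"
    using bij_betw_same_card by fastforce
  then show ?thesis
    by (simp add: two_subsets_def n_subsets)
qed

lemma perm_flip_adj_evenperm:
  assumes "perm_flip_adj n p q"
  shows "evenperm q \<longleftrightarrow> \<not> evenperm p"
proof -
  obtain i j where "i \<noteq> j" "q = p \<circ> transpose i j" "p permutes {1..n}"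
    using assms unfolding perm_flip_adj_def perm_flip_edge_def perm_flip_vertices_def by blast
  then show ?thesis
    using permutes_imp_permutation[of "{1..n}" p]
    by (simp add: evenperm_comp permutation_swap_id evenperm_swap)
qed

text \<open>The graph is bipartite: every edge joins an even and an odd permutation.\<close>

lemma is_cycle_perm_flip_even_length:
  assumes "is_cycle (perm_flip_adj n) vs"
  shows "even (length vs)"
proof -
  have adj: "\<And>k. k < length vs \<Longrightarrow> perm_flip_adj n (vs ! k) (vs ! (Suc k mod length vs))"
    using assms by (auto simp: is_cycle_def)
  \<comment> \<open>The index may reach \<open>length vs\<close>, where \<open>mod\<close> leads
    back to the start; comparing parities there gives the claim.\<close>
  have "k \<le> length vs \<Longrightarrow>
      evenperm (vs ! (k mod length vs)) \<longleftrightarrow> (evenperm (vs ! 0) \<longleftrightarrow> even k)" for k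
  proof (induction k)
    case (Suc k)
    then show ?case
      using perm_flip_adj_evenperm[OF adj[of k]] by auto
  qed simp
  from this[of "length vs"] show ?thesis
    by auto
qed

theorem theorem14:
  fixes n :: nat
  assumes "n \<ge> 2"
  shows "(odd (n div 2) \<longrightarrow> \<not> has_rainbow_cycle n) \<and>
         (even (n div 2) \<longrightarrow> has_rainbow_cycle n)"
proof (intro conjI impI)
  assume odd: "odd (n div 2)"
  show "\<not> has_rainbow_cycle n"
  proof
    assume "has_rainbow_cycle n"
    then obtain vs where vs: "is_rainbow_cycle n vs"
      by (auto simp: has_rainbow_cycle_def)
    then have "even (n choose 2)"
      using is_cycle_perm_flip_even_length is_rainbow_cycle_length
      unfolding is_rainbow_cycle_def by metis
    \<comment> \<open>With \<open>m = n div 2\<close> odd, the binomial coefficient is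
      \<open>m * (2 * m - 1)\<close> or \<open>(2 * m + 1) * m\<close>, a product of odd
      numbers.\<close>
    moreover have "odd (n choose 2)"
    proof (cases "even n")
      case True
      then obtain m where m: "n = 2 * m" by blast
      then have "n choose 2 = m * (n - 1)"
        by (simp add: choose_two)
      then show ?thesis
        using odd m by (cases m) auto
    next
      case False
      then obtain m where m: "n = 2 * m + 1"
        by (elim oddE)
      then have "n choose 2 = n * m"
        by (simp add: choose_two)
      then show ?thesis
        using odd m by auto
    qed
    ultimately show False
      by blast
  qed
next
  assume even: "even (n div 2)"
  \<comment> \<open>\<open>n = 2\<close> is excluded because \<open>2 div 2\<close> is odd.\<close>
  then have "n \<ge> 3"
    using assms by (cases "n = 2") auto
  then show "has_rainbow_cycle n"
    using rainbow_word_exists[OF assms even] is_rainbow_cycle_of_word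
    unfolding has_rainbow_cycle_def by blast
qed

end
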